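(* Let $K \ge 2$, and for $Q \in \Delta_K^{(2)}$ let $\mathrm{EU}(Q) = I(Y, \Theta)$ be the mutual information of the outcome $Y$ and the first-order distribution $\Theta \sim Q$. Then $\mathrm{EU}$ violates property A2. That is, $\mathrm{EU}$ is not maximal at the uniform distribution $Q_{\mathrm{unif}}$ on $\Delta_K$: there exists $Q \in \Delta_K^{(2)}$ with $\mathrm{EU}(Q) > \mathrm{EU}(Q_{\mathrm{unif}})$.
   Context: Let $\mathcal{Y} = \{y_1,\dots,y_K\}$ be a finite label space. The set of probability distributions on $\mathcal{Y}$ is identified with the simplex $\Delta_K = \{\theta = (\theta_1,\dots,\theta_K) \in [0,1]^K : \|\theta\|_1 = 1\}$, where $\theta_k = p(y_k \mid \theta)$. $\Delta_K^{(2)}$ denotes the set of (Borel) probability measures on $\Delta_K$ (second-order distributions). The uniform distribution $Q_{\mathrm{unif}}$ on $\Delta_K$ is the normalized $(K-1)$-dimensional Lebesgue measure on the simplex, i.e. the Dirichlet$(1,\dots,1)$ distribution; for $K=2$, identifying $\Delta_2$ with $[0,1]$, it is the uniform distribution on $[0,1]$. For $Q \in \Delta_K^{(2)}$, let $\Theta \sim Q$ and let $Y$ be the outcome with conditional distribution $p(\cdot \mid \theta)$ given $\Theta = \theta$, so its marginal is $p(y_k) = \int_{\Delta_K} \theta_k \, dQ(\theta)$. With logarithms in base 2 and $0 \log 0 = 0$: $H(Y) = -\sum_{y \in \mathcal{Y}} p(y) \log_2 p(y)$, $H(Y \mid \Theta) = \int_{\Delta_K} \left( -\sum_{k=1}^K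 \theta_k \log_2 \theta_k \right) dQ(\theta)$, $I(Y,\Theta) = H(Y) - H(Y \mid \Theta)$. Property A2 (for $\mathrm{EU}: \Delta_K^{(2)} \to \mathbb{R}$): $\mathrm{EU}$ is maximal for $Q$ being the uniform distribution on $\Delta_K$. *)

theory Defs
  imports "HOL-Probability.Probability"
begin

text \<open>Labels are the indices \<open>0, \<dots>, K - 1\<close>; vectors in \<open>\<real>\<^sup>K\<close> are extensional functions on \<open>{..<K}\<close>.\<close>

definition prob_simplex :: "nat \<Rightarrow> (nat \<Rightarrow> real) set" where
  "prob_simplex K = {\<theta> \<in> {..<K} \<rightarrow>\<^sub>E {0..1}. (\<Sum>k<K. \<bar>\<theta> k\<bar>) = 1}"

definition simplex_borel :: "nat \<Rightarrow> (nat \<Rightarrow> real) measure" where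
  "simplex_borel K = restrict_space (\<Pi>\<^sub>M k\<in>{..<K}. borel) (prob_simplex K)"

definition second_order :: "nat \<Rightarrow> (nat \<Rightarrow> real) measure set" where
  "second_order K = {Q. prob_space Q \<and> sets Q = sets (simplex_borel K)}"

text \<open>
  The simplex is the graph of \<open>\<theta> (K - 1) = 1 - (\<Sum>k<K - 1. \<theta> k)\<close> over the solid simplex in
  dimension \<open>K - 1\<close>. This affine chart scales \<open>(K - 1)\<close>-dimensional volume by a constant
  factor, so the normalized volume on the simplex is the image of normalized Lebesgue measure
  on the solid simplex. Equivalently, the Dirichlet density with all parameters \<open>1\<close> is constant
  in these coordinates. The measure is restricted to the solid simplex because only there does
  the chart take values in \<open>prob_simplex K\<close>.
\<close>

definition solid_simplex :: "nat \<Rightarrow> (nat \<Rightarrow> real) set" where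
  "solid_simplex n = {x \<in> {..<n} \<rightarrow>\<^sub>E {0..1}. (\<Sum>k<n. x k) \<le> 1}"

definition simplex_chart :: "nat \<Rightarrow> (nat \<Rightarrow> real) \<Rightarrow> nat \<Rightarrow> real" where
  "simplex_chart K x = x(K - 1 := 1 - (\<Sum>k<K - 1. x k))"

definition simplex_unif :: "nat \<Rightarrow> (nat \<Rightarrow> real) measure" where
  "simplex_unif K =
     distr (restrict_space
         (uniform_measure (\<Pi>\<^sub>M k\<in>{..<K - 1}. lborel) (solid_simplex (K - 1)))
         (solid_simplex (K - 1)))
       (simplex_borel K) (simplex_chart K)"

lemma solid_simplex_altdef:
  "solid_simplex n =
     {x. (\<forall>i\<in>{..<n}. 0 \<le> x i) \<and> sum x {..<n} \<le> 1} \<inter> space (\<Pi>\<^sub>M k\<in>{..<n}. lborel)"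
proof (intro set_eqI iffI)
  fix x :: "nat \<Rightarrow> real"
  assume x: "x \<in> {x. (\<forall>i\<in>{..<n}. 0 \<le> x i) \<and> sum x {..<n} \<le> 1} \<inter> space (\<Pi>\<^sub>M k\<in>{..<n}. lborel)"
  have "x i \<le> 1" if "i < n" for i
    using member_le_sum[of i "{..<n}" x] x that by auto
  with x show "x \<in> solid_simplex n"
    by (auto simp: solid_simplex_def space_PiM PiE_iff)
qed (auto simp: solid_simplex_def space_PiM PiE_iff)

lemma solid_simplex_measurable [measurable]:
  "solid_simplex n \<in> sets (\<Pi>\<^sub>M k\<in>{..<n}. lborel)"
proof -
  have "{x \<in> space (\<Pi>\<^sub>M k\<in>{..<n}. lborel). (\<forall>i\<in>{..<n}. 0 \<le> x i) \<and> sum x {..<n} \<le> (1::real)}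
      \<in> sets (\<Pi>\<^sub>M k\<in>{..<n}. lborel)"
    by measurable
  also have "{x \<in> space (\<Pi>\<^sub>M k\<in>{..<n}. lborel). (\<forall>i\<in>{..<n}. 0 \<le> x i) \<and> sum x {..<n} \<le> (1::real)}
      = solid_simplex n"
    unfolding solid_simplex_altdef by auto
  finally show ?thesis .
qed

lemma emeasure_solid_simplex:
  "emeasure (\<Pi>\<^sub>M k\<in>{..<n}. lborel) (solid_simplex n) = ennreal (1 / fact n)"
  unfolding solid_simplex_altdef
  by (subst emeasure_std_simplex_aux) auto

lemma simplex_chart_in_prob_simplex:
  assumes "K \<ge> 1" "x \<in> solid_simplex (K - 1)"
  shows "simplex_chart K x \<in> prob_simplex K"
proof -
  obtain n where K: "K = Suc n"
    using assms(1) by (cases K) auto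
  have x: "x \<in> {..<n} \<rightarrow>\<^sub>E {0..1}" "sum x {..<n} \<le> 1"
    using assms(2) by (simp_all add: K solid_simplex_def)
  have "0 \<le> sum x {..<n}"
    using x(1) by (intro sum_nonneg) (simp add: PiE_iff)
  moreover from this have "simplex_chart K x \<in> {..<K} \<rightarrow>\<^sub>E {0..1}"
    using x by (auto simp: K simplex_chart_def PiE_iff extensional_def less_Suc_eq)
  moreover have "(\<Sum>k<n. \<bar>simplex_chart K x k\<bar>) = sum x {..<n}"
    using x(1) by (intro sum.cong) (auto simp: K simplex_chart_def PiE_iff)
  moreover have "\<bar>simplex_chart K x n\<bar> = 1 - sum x {..<n}"
    using x(2) by (simp add: K simplex_chart_def)
  ultimately show ?thesis
    unfolding prob_simplex_def K by simp
qed

lemma simplex_unif_in_second_order: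
  assumes "K \<ge> 1"
  shows "simplex_unif K \<in> second_order K"
proof -
  let ?L = "\<Pi>\<^sub>M k\<in>{..<K - 1}. (lborel :: real measure)" and ?T = "solid_simplex (K - 1)"
  let ?R = "restrict_space (uniform_measure ?L ?T) ?T"
  have [measurable]: "?T \<in> sets ?L"
    by (rule solid_simplex_measurable)
  have "emeasure (uniform_measure ?L ?T) ?T = 1"
    by (simp add: emeasure_solid_simplex divide_eq_1_ennreal)
  hence "prob_space ?R"
    by (intro prob_spaceI) (simp add: emeasure_restrict_space space_restrict_space)
  moreover have "simplex_chart K \<in> measurable ?R (simplex_borel K)"
  proof -
    have "simplex_chart K \<in> measurable ?R (\<Pi>\<^sub>M k\<in>{..<K}. borel)"
    proof (rule measurable_PiM_single')
      show "simplex_chart K \<in> space ?R \<rightarrow> (\<Pi>\<^sub>E k\<in>{..<K}. space borel)"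
        using assms
        by (auto simp: simplex_chart_def space_restrict_space space_PiM PiE_iff extensional_def)
    next
      fix k assume "k \<in> {..<K}"
      show "(\<lambda>x. simplex_chart K x k) \<in> borel_measurable ?R"
      proof (cases "k = K - 1")
        case True
        have "(\<lambda>x. 1 - (\<Sum>i<K - 1. x i)) \<in> borel_measurable ?L"
          by measurable
        thus ?thesis
          using True by (auto simp: simplex_chart_def intro!: measurable_restrict_space1)
      next
        case False
        with \<open>k \<in> {..<K}\<close> have "k \<in> {..<K - 1}"
          by auto
        hence "(\<lambda>x. x k) \<in> borel_measurable ?L"
          by measurable
        thus ?thesis
          using False by (auto simp: simplex_chart_def intro!: measurable_restrict_space1)
      qed
    qed
    thus ?thesis
      unfolding simplex_borel_def using simplex_chart_in_prob_simplex[OF assms]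
      by (intro measurable_restrict_space2) (auto simp: space_restrict_space)
  qed
  ultimately show ?thesis
    by (simp add: second_order_def simplex_unif_def prob_space.prob_space_distr)
qed

definition marginal :: "(nat \<Rightarrow> real) measure \<Rightarrow> nat \<Rightarrow> real" where
  "marginal Q k = (\<integral>\<theta>. \<theta> k \<partial>Q)"

text \<open>The convention \<open>0 log 0 = 0\<close> holds because a product with \<open>0\<close> is \<open>0\<close>.\<close>

definition shannon_entropy :: "nat \<Rightarrow> (nat \<Rightarrow> real) \<Rightarrow> real" where
  "shannon_entropy K p = - (\<Sum>k<K. p k * log 2 (p k))"

definition outcome_entropy :: "nat \<Rightarrow> (nat \<Rightarrow> real) measure \<Rightarrow> real" where
  "outcome_entropy K Q = shannon_entropy K (marginal Q)"

definition cond_outcome_entropy :: "nat \<Rightarrow> (nat \<Rightarrow> real) measure \<Rightarrow> real" where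
  "cond_outcome_entropy K Q = (\<integral>\<theta>. shannon_entropy K \<theta> \<partial>Q)"

text \<open>The mutual information \<open>I(Y, \<Theta>) = H(Y) - H(Y | \<Theta>)\<close>.\<close>

definition EU :: "nat \<Rightarrow> (nat \<Rightarrow> real) measure \<Rightarrow> real" where
  "EU K Q = outcome_entropy K Q - cond_outcome_entropy K Q"

definition property_A2 :: "nat \<Rightarrow> ((nat \<Rightarrow> real) measure \<Rightarrow> real) \<Rightarrow> bool" where
  "property_A2 K U \<longleftrightarrow> (\<forall>Q \<in> second_order K. U Q \<le> U (simplex_unif K))"

end

theory Submission
  imports Defs
begin

text \<open>
  The mutual information never exceeds \<open>log 2 K\<close>, and the uniform mixture of the \<open>K\<close> Dirac measures at
  the vertices of the simplex attains this bound, since its outcome is uniform and is determined by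
  \<open>\<Theta>\<close>. For the uniform distribution the bound is strict: the conditional entropy is the
  integral of a nonnegative function that vanishes only at the vertices, which form a null set.
\<close>

text \<open>Unlike \<open>prob_simplex\<close>, this imposes nothing on values outside
  \<open>{..<K}\<close>, so it applies to \<open>marginal Q\<close> without discussing
  extensionality.\<close>

definition prob_vector :: "nat \<Rightarrow> (nat \<Rightarrow> real) \<Rightarrow> bool" where
  "prob_vector K p \<longleftrightarrow> (\<forall>k<K. 0 \<le> p k) \<and> (\<Sum>k<K. p k) = 1"

lemma prob_vector_le_1: "p k \<le> 1" if "prob_vector K p" "k < K"
  using that member_le_sum[of k "{..<K}" p] by (auto simp: prob_vector_def)

lemma prob_simplex_prob_vector: "prob_vector K \<theta>" if "\<theta> \<in> prob_simplex K"
proof -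
  have "\<forall>k<K. 0 \<le> \<theta> k"
    using that by (auto simp: prob_simplex_def PiE_iff)
  moreover from this have "(\<Sum>k<K. \<theta> k) = (\<Sum>k<K. \<bar>\<theta> k\<bar>)"
    by (intro sum.cong) auto
  ultimately show ?thesis
    using that by (simp add: prob_vector_def prob_simplex_def)
qed

section \<open>Shannon entropy of a probability vector\<close>

lemma mult_log_nonpos: "x * log 2 x \<le> 0" if "0 \<le> x" "x \<le> (1::real)"
  using that by (cases "x = 0") (auto simp: mult_nonneg_nonpos)

lemma shannon_entropy_nonneg: "0 \<le> shannon_entropy K p" if "prob_vector K p"
  unfolding shannon_entropy_def
  using that prob_vector_le_1[OF that]
  by (auto simp: prob_vector_def intro!: sum_nonpos mult_log_nonpos)

text \<open>A vanishing sum of nonnegative terms has only zero terms, and on [0,1] the function x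
  log x vanishes only at 0 and 1.\<close>

lemma shannon_entropy_eq_0D:
  assumes "prob_vector K p" "shannon_entropy K p = 0" "k < K"
  shows "p k = 0 \<or> p k = 1"
proof -
  have "p i * log 2 (p i) \<le> 0" if "i < K" for i
    using that assms(1) prob_vector_le_1[OF assms(1) that]
    by (intro mult_log_nonpos) (auto simp: prob_vector_def)
  moreover have "(\<Sum>i<K. - (p i * log 2 (p i))) = 0"
    using assms(2) by (simp add: shannon_entropy_def sum_negf)
  ultimately have "- (p k * log 2 (p k)) = 0"
    using assms(3) by (subst (asm) sum_nonneg_eq_0_iff) auto
  moreover have "0 \<le> p k"
    using assms by (simp add: prob_vector_def)
  ultimately show ?thesis
    using ln_eq_zero_iff[of "p k"] by (cases "p k = 0") (auto simp: log_def)
qed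

text \<open>Gibbs' inequality against the uniform distribution, derived from ln x \<le> x -
  1.\<close>

lemma shannon_entropy_le:
  assumes "prob_vector K p"
  shows "shannon_entropy K p \<le> log 2 K"
proof -
  have K: "0 < K"
    using assms by (cases K) (auto simp: prob_vector_def)
  \<comment> \<open>The tangent bound is taken at x = 1 / (p k * K) and multiplied by
    \<open>p k\<close>, so that the left-hand sides sum to 0. The case \<open>p k = 0\<close> is
    separate because ln is bounded only at positive arguments.\<close>
  have *: "p k - 1 / K \<le> p k * ln (p k) + p k * ln K" if "k < K" for k
  proof (cases "p k = 0")
    case False
    with that assms have pos: "0 < p k"
      by (auto simp: prob_vector_def less_le)
    have "ln (1 / (p k * K)) \<le> 1 / (p k * K) - 1"
      using pos K by (intro ln_le_minus_one) simp
    then have "p k * ln (1 / (p k * K)) \<le> p k * (1 / (p k * K) - 1)"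
      using pos by (intro mult_left_mono) auto
    then show ?thesis
      using pos K by (simp add: ln_div ln_mult algebra_simps)
  qed (use K in simp)
  have sum1: "(\<Sum>k<K. p k) = 1"
    using assms by (simp add: prob_vector_def)
  have "(\<Sum>k<K. p k - 1 / K) \<le> (\<Sum>k<K. p k * ln (p k) + p k * ln K)"
    by (intro sum_mono *) auto
  also have "(\<Sum>k<K. p k - 1 / K) = 0"
    using K by (simp add: sum_subtractf sum1)
  also have "(\<Sum>k<K. p k * ln (p k) + p k * ln K) = (\<Sum>k<K. p k * ln (p k)) + ln K"
    by (simp add: sum.distrib sum1 flip: sum_distrib_right)
  finally have "- (\<Sum>k<K. p k * ln (p k)) / ln 2 \<le> ln K / ln 2"
    by (intro divide_right_mono) auto
  then show ?thesis
    by (simp add: shannon_entropy_def log_def sum_divide_distrib)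
qed

section \<open>Measurability and integration for second-order distributions\<close>

lemma space_simplex_borel: "space (simplex_borel K) = prob_simplex K"
  by (auto simp: simplex_borel_def space_restrict_space space_PiM prob_simplex_def)

lemma space_second_order: "space Q = prob_simplex K" if "Q \<in> second_order K"
  using that sets_eq_imp_space_eq[of Q "simplex_borel K"]
  by (simp add: second_order_def space_simplex_borel)

lemma measurable_coord:
  assumes "k < K"
  shows "(\<lambda>\<theta>. \<theta> k) \<in> borel_measurable (simplex_borel K)"
  unfolding simplex_borel_def using assms
  by (intro measurable_restrict_space1 measurable_component_singleton) auto

lemma measurable_shannon_entropy [measurable]:
  "shannon_entropy K \<in> borel_measurable (simplex_borel K)"
proof -
  have "(\<lambda>\<theta>. \<theta> k * log 2 (\<theta> k)) \<in> borel_measurable (simplex_borel K)" if "k < K" for k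
    using measurable_coord[OF that] by measurable
  then show ?thesis
    unfolding shannon_entropy_def[abs_def]
    by (intro borel_measurable_uminus borel_measurable_sum) auto
qed

lemma second_order_AE_prob_vector: "AE \<theta> in Q. prob_vector K \<theta>" if "Q \<in> second_order K"
  using prob_simplex_prob_vector by (intro AE_I2) (auto simp: space_second_order[OF that])

text \<open>A bound on probability vectors suffices because \<open>Q\<close> lives on the simplex
  and has finite mass.\<close>

lemma second_order_integrable:
  fixes f :: "(nat \<Rightarrow> real) \<Rightarrow> real"
  assumes "Q \<in> second_order K" "f \<in> borel_measurable (simplex_borel K)"
    and "\<And>\<theta>. prob_vector K \<theta> \<Longrightarrow> \<bar>f \<theta>\<bar> \<le> B"
  shows "integrable Q f"
proof -
  interpret prob_space Q
    using assms(1) by (simp add: second_order_def)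
  have "f \<in> borel_measurable Q"
    using assms(1,2) by (simp add: second_order_def cong: measurable_cong_sets)
  then show ?thesis
    using second_order_AE_prob_vector[OF assms(1)] assms(3)
    by (intro integrable_const_bound[of _ B]) (auto elim!: eventually_mono)
qed

text \<open>Integration preserves nonnegativity and commutes with the finite coordinate sum. This
  makes the entropy bound available for the outcome distribution.\<close>

lemma prob_vector_marginal:
  assumes "Q \<in> second_order K"
  shows "prob_vector K (marginal Q)"
proof -
  interpret prob_space Q
    using assms by (simp add: second_order_def)
  have int: "integrable Q (\<lambda>\<theta>. \<theta> k)" if "k < K" for k
    using assms measurable_coord[OF that] prob_vector_le_1[OF _ that] that
    by (intro second_order_integrable[where B = 1]) (auto simp: prob_vector_def)
  have "0 \<le> marginal Q k" if "k < K" for k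
    unfolding marginal_def using second_order_AE_prob_vector[OF assms] that
    by (intro integral_nonneg_AE) (auto simp: prob_vector_def elim!: eventually_mono)
  moreover have "(\<Sum>k<K. marginal Q k) = 1"
  proof -
    have "(\<Sum>k<K. marginal Q k) = (\<integral>\<theta>. (\<Sum>k<K. \<theta> k) \<partial>Q)"
      unfolding marginal_def using int by (subst Bochner_Integration.integral_sum) auto
    also have "\<dots> = (\<integral>\<theta>. 1 \<partial>Q)"
      using prob_simplex_prob_vector
      by (intro Bochner_Integration.integral_cong)
        (auto simp: space_second_order[OF assms] prob_vector_def)
    finally show ?thesis
      by (simp add: prob_space)
  qed
  ultimately show ?thesis
    by (simp add: prob_vector_def)
qed

section \<open>The uniform distribution has positive conditional entropy\<close>

lemma null_sets_PiM_lborel_coord: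
  fixes c :: real
  assumes "finite I" "i \<in> I"
  shows "{x \<in> space (\<Pi>\<^sub>M k\<in>I. lborel). x i = c} \<in> null_sets (\<Pi>\<^sub>M k\<in>I. lborel)"
proof -
  interpret product_sigma_finite "\<lambda>_::'a. lborel :: real measure"
    by standard
  \<comment> \<open>The slice is a box with one degenerate side, which contributes a factor 0 to the
    product of lengths.\<close>
  let ?A = "\<lambda>k. if k = i then {c} else UNIV"
  have eq: "{x \<in> space (\<Pi>\<^sub>M k\<in>I. lborel). x i = c} = Pi\<^sub>E I ?A"
    using assms(2) by (auto simp: space_PiM PiE_iff extensional_def split: if_splits)
  have "emeasure (\<Pi>\<^sub>M k\<in>I. lborel) (Pi\<^sub>E I ?A) = (\<Prod>k\<in>I. emeasure lborel (?A k))"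
    using assms(1) by (intro emeasure_PiM) auto
  also have "\<dots> = 0"
    using assms by (intro prod_zero) auto
  finally show ?thesis
    using assms(1) by (auto simp: eq intro!: sets_PiM_I_finite)
qed

lemma measurable_simplex_chart:
  assumes "1 \<le> K"
    and M: "sets M = sets (\<Pi>\<^sub>M k\<in>{..<K - 1}. (lborel :: real measure))"
  shows "simplex_chart K
    \<in> measurable (restrict_space M (solid_simplex (K - 1))) (simplex_borel K)"
proof -
  let ?L = "\<Pi>\<^sub>M k\<in>{..<K - 1}. (lborel :: real measure)"
  have space: "space M = space ?L"
    using M by (rule sets_eq_imp_space_eq)
  have "(\<lambda>x. simplex_chart K x k) \<in> borel_measurable M" if "k < K" for k
  proof (cases "k = K - 1")
    case False
    with that have "k \<in> {..<K - 1}"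
      by auto
    then have "(\<lambda>x. x k) \<in> borel_measurable ?L"
      by measurable
    with False show ?thesis
      by (simp add: simplex_chart_def measurable_cong_sets[OF M refl])
  qed (simp add: simplex_chart_def measurable_cong_sets[OF M refl])
  then have "(\<lambda>x. \<lambda>k\<in>{..<K}. simplex_chart K x k) \<in> measurable M (\<Pi>\<^sub>M k\<in>{..<K}. borel)"
    by (intro measurable_restrict) auto
  \<comment> \<open>Points of the space are extensional on \<open>{..<K - 1}\<close> and the chart
    sets only index \<open>K - 1\<close>, so restricting to \<open>{..<K}\<close> changes
    nothing.\<close>
  moreover have "(\<lambda>k\<in>{..<K}. simplex_chart K x k) = simplex_chart K x" if "x \<in> space M" for x
    using that assms(1)
    by (auto simp: space space_PiM PiE_iff extensional_def simplex_chart_def)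
  ultimately have "simplex_chart K \<in> measurable M (\<Pi>\<^sub>M k\<in>{..<K}. borel)"
    by (simp cong: measurable_cong)
  then show ?thesis
    unfolding simplex_borel_def using simplex_chart_in_prob_simplex[OF assms(1)]
    by (intro measurable_restrict_space2 measurable_restrict_space1)
      (auto simp: space_restrict_space)
qed

text \<open>As K is at least 2, the chart overwrites an index other than 0, so the null slice of the
  solid simplex carries over to the simplex.\<close>

lemma simplex_unif_first_coord_AE:
  assumes "2 \<le> K"
  shows "AE \<theta> in simplex_unif K. \<theta> 0 \<noteq> c"
proof -
  let ?L = "\<Pi>\<^sub>M k\<in>{..<K - 1}. (lborel :: real measure)" and ?T = "solid_simplex (K - 1)"
  let ?R = "restrict_space (uniform_measure ?L ?T) ?T"
  have chart: "simplex_chart K \<in> measurable ?R (simplex_borel K)"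
    using assms by (intro measurable_simplex_chart) auto
  have "AE x in ?L. x 0 \<noteq> c"
    using null_sets_PiM_lborel_coord[of "{..<K - 1}" 0 c] assms
    by (intro AE_I'[of "{x \<in> space ?L. x 0 = c}"]) auto
  then have "AE x in uniform_measure ?L ?T. x 0 \<noteq> c"
    by (intro AE_uniform_measureI) auto
  then have "AE x in ?R. x 0 \<noteq> c"
    by (subst AE_restrict_space_iff) auto
  moreover have "simplex_chart K x 0 = x 0" for x
    using assms by (simp add: simplex_chart_def)
  moreover have "{\<theta> \<in> space (simplex_borel K). \<theta> 0 \<noteq> c} \<in> sets (simplex_borel K)"
    using measurable_sets[OF measurable_coord[of 0 K], of "- {c}"] assms
    by (simp add: vimage_def Int_def conj_commute)
  ultimately show ?thesis
    unfolding simplex_unif_def using chart by (subst AE_distr_iff) auto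
qed

text \<open>A zero integral would make the nonnegative integrand vanish almost everywhere, forcing
  the first coordinate into {0, 1}, which is a null event.\<close>

lemma cond_outcome_entropy_simplex_unif_pos:
  assumes "2 \<le> K"
  shows "0 < cond_outcome_entropy K (simplex_unif K)"
proof -
  let ?Q = "simplex_unif K"
  have Q: "?Q \<in> second_order K"
    using assms by (intro simplex_unif_in_second_order) simp
  then interpret prob_space ?Q
    by (simp add: second_order_def)
  have int: "integrable ?Q (shannon_entropy K)"
    using Q shannon_entropy_nonneg shannon_entropy_le
    by (intro second_order_integrable[where B = "log 2 K"]) auto
  have nonneg: "AE \<theta> in ?Q. 0 \<le> shannon_entropy K \<theta>"
    using second_order_AE_prob_vector[OF Q] by eventually_elim (rule shannon_entropy_nonneg)
  have "\<not> (AE \<theta> in ?Q. shannon_entropy K \<theta> = 0)"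
  proof
    assume "AE \<theta> in ?Q. shannon_entropy K \<theta> = 0"
    then have "AE \<theta> in ?Q. False"
      using second_order_AE_prob_vector[OF Q] simplex_unif_first_coord_AE[OF assms, of 0]
        simplex_unif_first_coord_AE[OF assms, of 1]
      by eventually_elim (use assms shannon_entropy_eq_0D[of K _ 0] in auto)
    then show False
      by simp
  qed
  then have "(\<integral>\<theta>. shannon_entropy K \<theta> \<partial>?Q) \<noteq> 0"
    using integral_nonneg_eq_0_iff_AE[OF int nonneg] by simp
  then show ?thesis
    using integral_nonneg_AE[OF nonneg] by (simp add: cond_outcome_entropy_def)
qed

section \<open>The uniform mixture of vertices\<close>

definition simplex_vertex :: "nat \<Rightarrow> nat \<Rightarrow> nat \<Rightarrow> real" where
  "simplex_vertex K i = (\<lambda>k\<in>{..<K}. of_bool (k = i))"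

text \<open>The restriction to \<open>{..<K}\<close> matters for measurability: for larger i,
  \<open>simplex_vertex K i\<close> is zero on all labels and lies outside the simplex.\<close>

definition vertex_mixture :: "nat \<Rightarrow> (nat \<Rightarrow> real) measure" where
  "vertex_mixture K =
     distr (restrict_space (measure_pmf (pmf_of_set {..<K})) {..<K}) (simplex_borel K) (simplex_vertex K)"

lemma simplex_vertex_in_prob_simplex: "simplex_vertex K i \<in> prob_simplex K" if "i < K"
  using that by (auto simp: prob_simplex_def simplex_vertex_def of_bool_def)

lemma measurable_simplex_vertex:
  "simplex_vertex K \<in> measurable (restrict_space (measure_pmf p) {..<K}) (simplex_borel K)"
proof (rule measurableI)
  show "simplex_vertex K -` A \<inter> space (restrict_space (measure_pmf p) {..<K})
      \<in> sets (restrict_space (measure_pmf p) {..<K})" for A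
    by (auto simp: sets_restrict_space space_restrict_space)
qed (simp add: space_restrict_space space_simplex_borel simplex_vertex_in_prob_simplex)

lemma integral_vertex_mixture:
  fixes f :: "(nat \<Rightarrow> real) \<Rightarrow> real"
  assumes "0 < K" "f \<in> borel_measurable (simplex_borel K)"
  shows "(\<integral>\<theta>. f \<theta> \<partial>vertex_mixture K) = (\<Sum>i<K. f (simplex_vertex K i)) / K"
proof -
  have "(\<integral>\<theta>. f \<theta> \<partial>vertex_mixture K) =
      (\<integral>i. f (simplex_vertex K i) \<partial>restrict_space (measure_pmf (pmf_of_set {..<K})) {..<K})"
    unfolding vertex_mixture_def by (intro integral_distr measurable_simplex_vertex assms)
  \<comment> \<open>The indicator trades the restricted space for the full
    \<open>pmf_of_set\<close>, whose integral is a finite average; on the support it equals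
    1.\<close>
  also have "\<dots> = (\<integral>i. indicator {..<K} i *\<^sub>R f (simplex_vertex K i) \<partial>pmf_of_set {..<K})"
    by (subst integral_restrict_space) auto
  also have "\<dots> = (\<Sum>i<K. f (simplex_vertex K i)) / K"
    using assms(1) by (subst integral_pmf_of_set) (auto intro!: sum.cong)
  finally show ?thesis .
qed

lemma vertex_mixture_in_second_order:
  assumes "0 < K"
  shows "vertex_mixture K \<in> second_order K"
proof -
  have "emeasure (measure_pmf (pmf_of_set {..<K})) {..<K} = 1"
    using assms by (subst emeasure_pmf_of_set) (auto simp: lessThan_empty_iff)
  then have "prob_space (restrict_space (measure_pmf (pmf_of_set {..<K})) {..<K})"
    by (intro prob_spaceI) (simp add: emeasure_restrict_space space_restrict_space)
  then show ?thesis
    using measurable_simplex_vertex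
    by (simp add: second_order_def vertex_mixture_def prob_space.prob_space_distr)
qed

text \<open>Each label has coordinate 1 at exactly one vertex, so the outcome is uniform; every
  vertex has entropy 0, so nothing is subtracted.\<close>

lemma EU_vertex_mixture:
  assumes "0 < K"
  shows "EU K (vertex_mixture K) = log 2 K"
proof -
  have "marginal (vertex_mixture K) k = 1 / K" if "k < K" for k
    using that assms measurable_coord[OF that]
    by (simp add: marginal_def integral_vertex_mixture simplex_vertex_def of_bool_def)
  then have "outcome_entropy K (vertex_mixture K) = log 2 K"
    using assms by (simp add: outcome_entropy_def shannon_entropy_def log_divide)
  moreover have "shannon_entropy K (simplex_vertex K i) = 0" for i
    unfolding shannon_entropy_def simplex_vertex_def by (auto intro!: sum.neutral)
  then have "cond_outcome_entropy K (vertex_mixture K) = 0"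
    using assms by (simp add: cond_outcome_entropy_def integral_vertex_mixture)
  ultimately show ?thesis
    by (simp add: EU_def)
qed

theorem proposition2:
  fixes K :: nat
  assumes "K \<ge> 2"
  shows "\<not> property_A2 K (EU K) \<and>
    (\<exists>Q \<in> second_order K. EU K Q > EU K (simplex_unif K))"
proof -
  have "simplex_unif K \<in> second_order K"
    using assms by (intro simplex_unif_in_second_order) simp
  then have "outcome_entropy K (simplex_unif K) \<le> log 2 K"
    unfolding outcome_entropy_def by (intro shannon_entropy_le prob_vector_marginal)
  \<comment> \<open>The bound on the outcome entropy is not strict; strictness comes from
    subtracting a positive conditional entropy.\<close>
  then have "EU K (simplex_unif K) < log 2 K"
    using cond_outcome_entropy_simplex_unif_pos[OF assms] by (simp add: EU_def)
  then have "\<exists>Q \<in> second_order K. EU K Q > EU K (simplex_unif K)"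
    using assms EU_vertex_mixture[of K] vertex_mixture_in_second_order[of K]
    by (intro bexI[of _ "vertex_mixture K"]) auto
  then show ?thesis
    by (auto simp: property_A2_def not_le)
qed

end
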